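(* Let $(\Omega,\mathcal A)$ be a measurable space and let $K:\Omega\to\mathcal K'(\mathbb{C}^n)$ be a random compact set in $\mathbb{C}^n$. Then the Siciak extremal function and the pluricomplex Green function of $K$ are random functions; that is, the functions $(\omega,z)\mapsto\Phi_{K(\omega)}(z)$ and $(\omega,z)\mapsto V_{K(\omega)}(z)=\log\Phi_{K(\omega)}(z)$ on $\Omega\times\mathbb{C}^n$ are random functions into $\mathbb{R}\cup\{\infty\}$.
   Context: $\mathcal K'(\mathbb{C}^n)$ denotes the space of non-empty compact subsets of $\mathbb{C}^n$ with the Hausdorff distance and its Borel $\sigma$-algebra. A random compact set in $\mathbb{C}^n$ is a measurable function $\Omega\to\mathcal K'(\mathbb{C}^n)$. For a non-empty compact set $Q\subset\mathbb{C}^n$ and $z\in\mathbb{C}^n$, the Siciak extremal function is $$\Phi_Q(z)=\sup\bigl\{|p(z)|^{1/\deg p}: p\in P(\mathbb{C}^n),\ \|p\|_Q\le1,\ \deg(p)\ge1\bigr\},$$ where $P(\mathbb{C}^n)$ is the set of complex polynomials on $\mathbb{C}^n$ and $\|p\|_Q=\max_{x\in Q}|p(x)|$; the pluricomplex Green function is $V_Q(z)=\log\Phi_Q(z)$ (with $\log\infty=\infty$). A function $h:\Omega\times\mathbb{C}^n\to\mathbb{R}\cup\{\infty\}$ is a random function if $h(\cdot,z)$ is measurable on $(\Omega,\mathcal A)$ for each $z\in\mathbb{C}^n$ (Borel $\sigma$-algebra on $\mathbb{R}\cup\{\infty\}$). *)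

theory Defs
  imports "HOL-Analysis.Analysis" "HOL-Library.Poly_Mapping"
begin

section \<open>The metric space of non-empty compact sets\<close>

definition hausdorff_dist :: "'a::metric_space set \<Rightarrow> 'a set \<Rightarrow> real" where
  "hausdorff_dist A B = max (SUP a\<in>A. infdist a B) (SUP b\<in>B. infdist b A)"

lemma bdd_above_infdist_image:
  fixes A :: "'a::metric_space set"
  assumes "compact A"
  shows "bdd_above ((\<lambda>a. infdist a B) ` A)"
  by (intro bounded_imp_bdd_above compact_imp_bounded compact_continuous_image
      continuous_on_infdist continuous_on_id assms)

lemma hausdorff_dist_le_iff:
  fixes A B :: "'a::metric_space set"
  assumes "compact A" "A \<noteq> {}" "compact B" "B \<noteq> {}"
  shows "hausdorff_dist A B \<le> r \<longleftrightarrow> (\<forall>a\<in>A. infdist a B \<le> r) \<and> (\<forall>b\<in>B. infdist b A \<le> r)"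
  unfolding hausdorff_dist_def
  by (simp add: cSUP_le_iff bdd_above_infdist_image assms)

lemma infdist_trans:
  fixes A B C :: "'a::metric_space set"
  assumes "B \<noteq> {}" "\<And>b. b \<in> B \<Longrightarrow> infdist b C \<le> s"
  shows "infdist a C \<le> infdist a B + s"
proof -
  have "infdist a C - s \<le> infdist a B"
    unfolding infdist_notempty[OF assms(1)]
  proof (rule cINF_greatest[OF assms(1)])
    fix b assume "b \<in> B"
    then show "infdist a C - s \<le> dist a b"
      using infdist_triangle[of a C b] assms(2)[of b] by linarith
  qed
  then show ?thesis by linarith
qed

typedef (overloaded) 'a nonempty_compact = "{K :: 'a::metric_space set. compact K \<and> K \<noteq> {}}"
  morphisms to_set Abs_nonempty_compact
  by (intro exI[of _ "{undefined}"]) simp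

lemma compact_to_set: "compact (to_set K)" and to_set_nonempty: "to_set K \<noteq> {}"
  using to_set[of K] by auto

instantiation nonempty_compact :: (metric_space) metric_space
begin

definition dist_nonempty_compact :: "'a nonempty_compact \<Rightarrow> 'a nonempty_compact \<Rightarrow> real" where
  "dist_nonempty_compact A B = hausdorff_dist (to_set A) (to_set B)"

definition uniformity_nonempty_compact :: "('a nonempty_compact \<times> 'a nonempty_compact) filter" where
  "uniformity_nonempty_compact = (INF e\<in>{0<..}. principal {(x, y). dist x y < e})"

definition open_nonempty_compact :: "'a nonempty_compact set \<Rightarrow> bool" where
  "open_nonempty_compact U \<longleftrightarrow> (\<forall>x\<in>U. \<forall>\<^sub>F (x', y) in uniformity. x' = x \<longrightarrow> y \<in> U)"

instance
proof
  fix A B C :: "'a nonempty_compact"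
  note iff = hausdorff_dist_le_iff[OF compact_to_set to_set_nonempty compact_to_set to_set_nonempty]
  have sym: "dist X Y = dist Y X" for X Y :: "'a nonempty_compact"
    by (simp add: dist_nonempty_compact_def hausdorff_dist_def max.commute)
  have le: "infdist x (to_set Y) \<le> dist X Y" if "x \<in> to_set X" for x and X Y :: "'a nonempty_compact"
    using iff[of X Y "dist X Y"] that by (simp add: dist_nonempty_compact_def)
  have sub: "to_set X \<subseteq> to_set Y" if "dist X Y = 0" for X Y :: "'a nonempty_compact"
  proof
    fix x assume "x \<in> to_set X"
    then have "infdist x (to_set Y) = 0"
      using le[of x X Y] that infdist_nonneg[of x "to_set Y"] by simp
    then show "x \<in> to_set Y"
      by (simp add: in_closed_iff_infdist_zero compact_imp_closed compact_to_set to_set_nonempty)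
  qed
  show "dist A B = 0 \<longleftrightarrow> A = B"
  proof
    assume "dist A B = 0"
    then have "to_set A = to_set B"
      using sub[of A B] sub[of B A] sym[of A B] by auto
    then show "A = B" by (simp add: to_set_inject)
  next
    assume "A = B"
    then show "dist A B = 0"
      by (simp add: dist_nonempty_compact_def hausdorff_dist_def to_set_nonempty)
  qed
  have one: "infdist x (to_set Z) \<le> dist X Y + dist Y Z" if "x \<in> to_set X"
    for x and X Y Z :: "'a nonempty_compact"
    using infdist_trans[of "to_set Y" "to_set Z" "dist Y Z" x, OF to_set_nonempty le]
      le[OF that, of Y] by linarith
  show "dist A B \<le> dist A C + dist B C"
    unfolding dist_nonempty_compact_def[of A B] iff
  proof (intro conjI ballI)
    fix a assume "a \<in> to_set A"
    then show "infdist a (to_set B) \<le> dist A C + dist B C"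
      using one[of a A B C] sym[of C B] by linarith
  next
    fix b assume "b \<in> to_set B"
    then show "infdist b (to_set A) \<le> dist A C + dist B C"
      using one[of b B A C] sym[of C A] by linarith
  qed
qed (fact uniformity_nonempty_compact_def open_nonempty_compact_def)+

end

definition random_compact_set :: "'w measure \<Rightarrow> ('w \<Rightarrow> (complex ^ 'n) nonempty_compact) \<Rightarrow> bool" where
  "random_compact_set M K \<longleftrightarrow> K \<in> borel_measurable M"

section \<open>Complex polynomials in several variables\<close>

text \<open>
  Variables are indexed by \<^typ>\<open>'n\<close>; a monomial is its exponent vector, and a polynomial is the
  finitely supported family of its coefficients.
\<close>

type_synonym 'n cpoly = "('n \<Rightarrow>\<^sub>0 nat) \<Rightarrow>\<^sub>0 complex"

definition cpoly_eval :: "'n::finite cpoly \<Rightarrow> complex ^ 'n \<Rightarrow> complex" where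
  "cpoly_eval p z =
    (\<Sum>m\<in>Poly_Mapping.keys p. Poly_Mapping.lookup p m * (\<Prod>i\<in>UNIV. (z $ i) ^ Poly_Mapping.lookup m i))"

text \<open>Total degree, with the convention that the zero polynomial has degree 0.\<close>

definition cpoly_degree :: "'n::finite cpoly \<Rightarrow> nat" where
  "cpoly_degree p = Max (insert 0 ((\<lambda>m. \<Sum>i\<in>UNIV. Poly_Mapping.lookup m i) ` Poly_Mapping.keys p))"

definition cpoly_norm_on :: "'n::finite cpoly \<Rightarrow> (complex ^ 'n) nonempty_compact \<Rightarrow> real" where
  "cpoly_norm_on p Q = (SUP x\<in>to_set Q. cmod (cpoly_eval p x))"

text \<open>The supremum defining the norm is a maximum.\<close>

lemma cpoly_norm_on_is_max:
  obtains x where "x \<in> to_set Q" "cpoly_norm_on p Q = cmod (cpoly_eval p x)"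
    "\<And>y. y \<in> to_set Q \<Longrightarrow> cmod (cpoly_eval p y) \<le> cmod (cpoly_eval p x)"
proof -
  have "continuous_on (to_set Q) (\<lambda>x. cmod (cpoly_eval p x))"
    unfolding cpoly_eval_def by (intro continuous_intros)
  then obtain x where x: "x \<in> to_set Q"
    "\<And>y. y \<in> to_set Q \<Longrightarrow> cmod (cpoly_eval p y) \<le> cmod (cpoly_eval p x)"
    using continuous_attains_sup[OF compact_to_set to_set_nonempty] by blast
  then have "cpoly_norm_on p Q = cmod (cpoly_eval p x)"
    unfolding cpoly_norm_on_def by (intro cSup_eq_maximum) auto
  with x show ?thesis using that by blast
qed

section \<open>Extremal functions\<close>

definition siciak_extremal :: "(complex ^ 'n::finite) nonempty_compact \<Rightarrow> complex ^ 'n \<Rightarrow> ereal" where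
  "siciak_extremal Q z =
    (SUP p\<in>{p. cpoly_norm_on p Q \<le> 1 \<and> cpoly_degree p \<ge> 1}.
       ereal (cmod (cpoly_eval p z) powr (1 / real (cpoly_degree p))))"

text \<open>The logarithm on \<open>[0, \<infinity>]\<close>, where \<open>log 0 = -\<infinity>\<close>; the values at negative arguments are irrelevant.\<close>

definition log_ereal :: "ereal \<Rightarrow> ereal" where
  "log_ereal x = (if x = \<infinity> then \<infinity> else if x > 0 then ereal (ln (real_of_ereal x)) else -\<infinity>)"

definition pluricomplex_green :: "(complex ^ 'n::finite) nonempty_compact \<Rightarrow> complex ^ 'n \<Rightarrow> ereal" where
  "pluricomplex_green Q z = log_ereal (siciak_extremal Q z)"

section \<open>Random functions with values in the reals extended by \<open>\<infinity>\<close>\<close>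

text \<open>
  Measurability into the restricted space includes that the value \<open>-\<infinity>\<close> is not taken.
\<close>

definition random_function :: "'w measure \<Rightarrow> ('w \<Rightarrow> complex ^ 'n \<Rightarrow> ereal) \<Rightarrow> bool" where
  "random_function M h \<longleftrightarrow> (\<forall>z. (\<lambda>\<omega>. h \<omega> z) \<in> M \<rightarrow>\<^sub>M restrict_space borel {-\<infinity><..})"

end

(* For fixed z the map Q \<mapsto> \<Phi>_Q(z) is lower semicontinuous on the hyperspace: if a
   competitor p satisfies |p(z)|^(1/deg p) > a, then so does c p for some c < 1, and the bound
   |c p| < 1 on Q is an open condition on Q. For the Green function one also needs \<Phi>_Q(z) > 0,
   which a competitor 1/2 + \<delta> w_i with small \<delta> > 0 shows. *)

theory Submission
  imports Defs
begin

lemma infdist_le_dist_nonempty_compact: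
  assumes "x \<in> to_set A"
  shows "infdist x (to_set B) \<le> dist A B"
  using hausdorff_dist_le_iff[OF compact_to_set to_set_nonempty compact_to_set to_set_nonempty,
      of A B "dist A B"] assms
  by (simp add: dist_nonempty_compact_def)

text \<open>By compactness a whole \<open>e\<close>-neighbourhood of \<open>to_set Q\<close> still
  lies in \<open>U\<close>, and Hausdorff distance below \<open>e\<close> forces every point of
  \<open>to_set R\<close> into that neighbourhood.\<close>

lemma open_to_set_subset:
  fixes U :: "'a::heine_borel set"
  assumes "open U"
  shows "open {Q. to_set Q \<subseteq> U}"
  unfolding open_dist
proof (intro ballI)
  fix Q :: "'a nonempty_compact"
  assume "Q \<in> {Q. to_set Q \<subseteq> U}"
  then obtain e where e: "e > 0" "(\<Union>x\<in>to_set Q. ball x e) \<subseteq> U"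
    using compact_subset_open_imp_ball_epsilon_subset[OF compact_to_set assms] by blast
  have "x \<in> U" if "dist R Q < e" "x \<in> to_set R" for R x
  proof -
    obtain y where "y \<in> to_set Q" "infdist x (to_set Q) = dist x y"
      using infdist_attains_inf[OF compact_imp_closed[OF compact_to_set] to_set_nonempty] by blast
    moreover have "infdist x (to_set Q) < e"
      using infdist_le_dist_nonempty_compact[OF that(2), of Q] that(1) by linarith
    ultimately have "x \<in> (\<Union>x\<in>to_set Q. ball x e)"
      by (auto simp: dist_commute)
    then show ?thesis
      using e(2) by blast
  qed
  then show "\<exists>e>0. \<forall>R. dist R Q < e \<longrightarrow> R \<in> {Q. to_set Q \<subseteq> U}"
    using e(1) by blast
qed

lemma continuous_on_cpoly_eval: "continuous_on S (cpoly_eval p)"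
  unfolding cpoly_eval_def by (intro continuous_intros)

lemma cpoly_norm_on_le_iff:
  "cpoly_norm_on p Q \<le> r \<longleftrightarrow> (\<forall>x\<in>to_set Q. cmod (cpoly_eval p x) \<le> r)"
  by (rule cpoly_norm_on_is_max[of Q p]) (metis order_trans)

text \<open>No coefficient vanishes under multiplication by a nonzero constant. Shrinking a
  competitor therefore leaves its degree, and with it the root taken in the extremal function,
  unchanged.\<close>

lemma keys_map_mult:
  fixes p :: "'a \<Rightarrow>\<^sub>0 complex"
  assumes "c \<noteq> 0"
  shows "Poly_Mapping.keys (Poly_Mapping.map ((*) c) p) = Poly_Mapping.keys p"
  using assms by (auto simp: in_keys_iff map.rep_eq when_def)

lemma cpoly_eval_map_mult:
  assumes "c \<noteq> 0"
  shows "cpoly_eval (Poly_Mapping.map ((*) c) p) z = c * cpoly_eval p z"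
  unfolding cpoly_eval_def keys_map_mult[OF assms] sum_distrib_left
  by (intro sum.cong) (auto simp: map.rep_eq when_def in_keys_iff)

lemma cpoly_degree_map_mult:
  assumes "c \<noteq> 0"
  shows "cpoly_degree (Poly_Mapping.map ((*) c) p) = cpoly_degree p"
  unfolding cpoly_degree_def keys_map_mult[OF assms] ..

lemma siciak_extremal_ge:
  assumes "cpoly_norm_on p Q \<le> 1" "cpoly_degree p \<ge> 1"
  shows "ereal (cmod (cpoly_eval p z) powr (1 / real (cpoly_degree p))) \<le> siciak_extremal Q z"
  unfolding siciak_extremal_def using assms by (intro SUP_upper) simp

text \<open>The strict bound places \<open>to_set Q\<close> inside an open set, which is the form
  that \<open>open_to_set_subset\<close> can use.\<close>

lemma less_siciak_extremal_strict:
  assumes "a < siciak_extremal Q z"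
  obtains p where "\<forall>x\<in>to_set Q. cmod (cpoly_eval p x) < 1" "cpoly_degree p \<ge> 1"
    "a < ereal (cmod (cpoly_eval p z) powr (1 / real (cpoly_degree p)))"
proof -
  obtain p where p: "cpoly_norm_on p Q \<le> 1" "cpoly_degree p \<ge> 1"
    "a < ereal (cmod (cpoly_eval p z) powr (1 / real (cpoly_degree p)))"
    using assms unfolding siciak_extremal_def less_SUP_iff by blast
  let ?r = "1 / real (cpoly_degree p)"
  \<comment> \<open>Degree at least 1 makes the exponent positive, so \<open>powr\<close> is
    continuous even at base 0. This covers the case where \<open>p\<close> vanishes at
    \<open>z\<close>, which can occur for negative \<open>a\<close>.\<close>
  have "((\<lambda>c::real. ereal ((c * cmod (cpoly_eval p z)) powr ?r)) \<longlongrightarrow>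
      ereal ((1 * cmod (cpoly_eval p z)) powr ?r)) (at_left 1)"
    using p(2) by (intro tendsto_ereal tendsto_powr' tendsto_intros) auto
  then have "eventually (\<lambda>c. a < ereal ((c * cmod (cpoly_eval p z)) powr ?r)) (at_left 1)"
    using p(3) by (intro order_tendstoD(1)) auto
  moreover have "eventually (\<lambda>c::real. c \<in> {0<..<1}) (at_left 1)"
    by (rule eventually_at_left_real) simp
  ultimately have "eventually (\<lambda>c. a < ereal ((c * cmod (cpoly_eval p z)) powr ?r) \<and>
      c \<in> {0<..<1}) (at_left 1)"
    by (rule eventually_conj)
  then obtain c :: real where c: "a < ereal ((c * cmod (cpoly_eval p z)) powr ?r)" "0 < c" "c < 1"
    using eventually_happens'[OF trivial_limit_at_left_real] by fastforce
  let ?q = "Poly_Mapping.map ((*) (complex_of_real c)) p"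
  have eval: "cmod (cpoly_eval ?q x) = c * cmod (cpoly_eval p x)" for x
    using c(2) by (simp add: cpoly_eval_map_mult norm_mult)
  have "c * cmod (cpoly_eval p x) < 1" if "x \<in> to_set Q" for x
  proof -
    have "c * cmod (cpoly_eval p x) \<le> c * 1"
      using p(1) that c(2) by (intro mult_left_mono) (auto simp: cpoly_norm_on_le_iff)
    then show ?thesis
      using c(3) by linarith
  qed
  then show ?thesis
    using that[of ?q] c p(2) by (simp add: eval cpoly_degree_map_mult)
qed

lemma open_less_siciak_extremal:
  fixes z :: "complex ^ 'n"
  shows "open {Q. a < siciak_extremal Q z}"
proof (subst open_subopen, intro ballI)
  fix Q :: "(complex ^ 'n) nonempty_compact"
  assume "Q \<in> {Q. a < siciak_extremal Q z}"
  then obtain p where p: "\<forall>x\<in>to_set Q. cmod (cpoly_eval p x) < 1" "cpoly_degree p \<ge> 1"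
    "a < ereal (cmod (cpoly_eval p z) powr (1 / real (cpoly_degree p)))"
    by (auto elim: less_siciak_extremal_strict)
  let ?U = "{x. cmod (cpoly_eval p x) < 1}"
  have "open {R. to_set R \<subseteq> ?U}"
    by (intro open_to_set_subset open_Collect_less continuous_intros continuous_on_cpoly_eval)
  \<comment> \<open>The value at \<open>z\<close> does not involve the compact set, so the same
    \<open>p\<close> serves as a competitor for every \<open>R\<close> inside
    \<open>?U\<close>.\<close>
  moreover have "a < siciak_extremal R z" if "to_set R \<subseteq> ?U" for R
    using that by (intro less_le_trans[OF p(3)] siciak_extremal_ge p(2))
      (auto simp: cpoly_norm_on_le_iff intro!: less_imp_le)
  ultimately show "\<exists>T. open T \<and> Q \<in> T \<and> T \<subseteq> {Q. a < siciak_extremal Q z}"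
    using p(1) by (intro exI[of _ "{R. to_set R \<subseteq> ?U}"]) auto
qed

text \<open>The rays above a point generate the Borel sets of the extended reals, so open superlevel
  sets suffice.\<close>

lemma borel_measurable_siciak_extremal: "(\<lambda>Q. siciak_extremal Q z) \<in> borel_measurable borel"
  by (rule borel_measurableI_greater) (simp add: open_less_siciak_extremal)

lemma
  fixes i :: "'n::finite"
  assumes "a \<noteq> 0" "b \<noteq> 0"
  defines "p \<equiv> Poly_Mapping.single 0 a + Poly_Mapping.single (Poly_Mapping.single i 1) b"
  shows cpoly_eval_affine: "cpoly_eval p z = a + b * z $ i"
    and cpoly_degree_affine: "cpoly_degree p = 1"
proof -
  \<comment> \<open>The constant monomial and the \<open>i\<close>-th coordinate are distinct
    exponent vectors, so their coefficients do not add up or cancel.\<close>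
  have ne: "Poly_Mapping.single i (1::nat) \<noteq> 0"
    by (metis lookup_single_eq lookup_zero one_neq_zero)
  then have keys: "Poly_Mapping.keys p = {0, Poly_Mapping.single i 1}"
    using assms(1,2) by (auto simp: p_def in_keys_iff lookup_add lookup_single when_def split: if_splits)
  have deg: "(\<Sum>j\<in>UNIV. Poly_Mapping.lookup (Poly_Mapping.single i (1::nat)) j) = 1"
    by (simp add: lookup_single when_def)
  have mono: "(\<Prod>j\<in>UNIV. z $ j ^ Poly_Mapping.lookup (Poly_Mapping.single i (1::nat)) j) = z $ i"
    by (simp add: lookup_single when_def if_distrib prod.delta cong: if_cong)
  show "cpoly_degree p = 1"
    unfolding cpoly_degree_def keys using deg by simp
  show "cpoly_eval p z = a + b * z $ i"
    unfolding cpoly_eval_def keys using ne mono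
    by (simp add: p_def lookup_add lookup_single)
qed

lemma siciak_extremal_pos:
  fixes z :: "complex ^ 'n"
  shows "0 < siciak_extremal Q z"
proof -
  fix i :: 'n
  \<comment> \<open>The point \<open>z\<close> is included so that one \<open>B\<close> controls
    both the upper bound on \<open>Q\<close> and the lower bound at \<open>z\<close>.\<close>
  have "bounded (insert z (to_set Q))"
    by (simp add: compact_imp_bounded compact_to_set)
  then obtain B where B: "B > 0" "\<And>x. x \<in> insert z (to_set Q) \<Longrightarrow> norm x \<le> B"
    unfolding bounded_pos by blast
  \<comment> \<open>With this scale the linear term has modulus at most 1/4 at \<open>z\<close> and
    on \<open>Q\<close>. Added to 1/2, it gives modulus at most 3/4 on \<open>Q\<close> and at least
    1/4 at \<open>z\<close>.\<close>
  define \<delta> where "\<delta> = complex_of_real (1 / (4 * B))"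
  have small: "cmod (\<delta> * x $ i) \<le> 1 / 4" if "x \<in> insert z (to_set Q)" for x
    using order_trans[OF Finite_Cartesian_Product.norm_nth_le B(2)[OF that], of i] B(1)
    by (simp add: \<delta>_def norm_mult norm_divide field_simps)
  let ?p = "Poly_Mapping.single 0 (1 / 2) + Poly_Mapping.single (Poly_Mapping.single i 1) \<delta>"
  have "\<delta> \<noteq> 0"
    using B(1) by (simp add: \<delta>_def)
  then have eval: "cpoly_eval ?p x = 1 / 2 + \<delta> * x $ i" and deg: "cpoly_degree ?p = 1" for x
    using cpoly_eval_affine[of "1 / 2" \<delta> i x] cpoly_degree_affine[of "1 / 2" \<delta> i] by simp_all
  have "cmod (cpoly_eval ?p x) \<le> 1" if "x \<in> to_set Q" for x
    unfolding eval using norm_triangle_ineq[of "1 / 2" "\<delta> * x $ i"] small[of x] that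
    by (simp add: norm_divide)
  \<comment> \<open>The degree is 1, so the exponent in the extremal function is 1 and no root
    remains.\<close>
  then have "ereal (cmod (cpoly_eval ?p z)) \<le> siciak_extremal Q z"
    using siciak_extremal_ge[of ?p Q z] deg by (simp add: cpoly_norm_on_le_iff)
  moreover have "0 < cmod (cpoly_eval ?p z)"
  proof -
    have "cmod (1 / 2) - cmod (\<delta> * z $ i) \<le> cmod (cpoly_eval ?p z)"
      unfolding eval by (rule norm_diff_ineq)
    then show ?thesis
      using small[of z] by (simp add: norm_divide del: zero_less_norm_iff)
  qed
  ultimately show ?thesis
    by (metis ereal_less(2) less_le_trans)
qed

lemma borel_measurable_log_ereal: "log_ereal \<in> borel_measurable borel"
  unfolding log_ereal_def by measurable

theorem theorem4p19:
  fixes M :: "'w measure" and K :: "'w \<Rightarrow> (complex ^ 'n) nonempty_compact"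
  assumes "random_compact_set M K"
  shows "random_function M (\<lambda>\<omega> z. siciak_extremal (K \<omega>) z) \<and>
         random_function M (\<lambda>\<omega> z. pluricomplex_green (K \<omega>) z)"
proof -
  have siciak: "(\<lambda>\<omega>. siciak_extremal (K \<omega>) z) \<in> borel_measurable M" for z
    using assms unfolding random_compact_set_def
    by (rule measurable_compose) (rule borel_measurable_siciak_extremal)
  then have "(\<lambda>\<omega>. pluricomplex_green (K \<omega>) z) \<in> borel_measurable M" for z
    unfolding pluricomplex_green_def
    by (rule measurable_compose) (rule borel_measurable_log_ereal)
  \<comment> \<open>\<open>random_function\<close> also demands that -\<infinity> is never attained.
    \<open>log_ereal\<close> takes that value only at arguments that are not positive, which
    \<open>siciak_extremal_pos\<close> excludes.\<close>
  moreover have "-\<infinity> < siciak_extremal Q z" and "-\<infinity> < pluricomplex_green Q z"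
    for Q :: "(complex ^ 'n) nonempty_compact" and z
    using siciak_extremal_pos[of Q z] by (auto simp: pluricomplex_green_def log_ereal_def)
  ultimately show ?thesis
    using siciak by (auto simp: random_function_def intro!: measurable_restrict_space2)
qed

end
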